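(* Let $T_1$ be an oriented tree and $P_2$ an oriented path with $T_1<P_2$ in the homomorphism order. If $h(P_2)\ge 4$, then there exists an oriented tree $T$ with $T_1<T<P_2$.
   Context: All digraphs are finite. A homomorphism $f:G_1\to G_2$ between digraphs is a map $V(G_1)\to V(G_2)$ sending arcs to arcs; write $G_1\le G_2$ if one exists, and $G_1<G_2$ if $G_1\le G_2$ and $G_2\not\le G_1$. An oriented path is a digraph whose vertices can be listed $p_0,\dots,p_n$ so that its arcs are exactly one arc between $p_{i-1}$ and $p_i$ (in either direction) for each $i$; an oriented tree is an orientation of a finite tree. $\vec P_k$ denotes the directed path with vertices $0,\dots,k$ and arcs $01,12,\dots,(k-1)k$. The height $h(P)$ of an oriented path $P$ is the minimum $k\ge0$ with $P\to\vec P_k$. *)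

theory Defs
  imports Main
begin

text \<open>A finite digraph: a vertex set together with an arc relation on it.\<close>
type_synonym 'a digraph = "'a set \<times> ('a \<times> 'a) set"

definition verts :: "'a digraph \<Rightarrow> 'a set" where "verts G = fst G"
definition arcs :: "'a digraph \<Rightarrow> ('a \<times> 'a) set" where "arcs G = snd G"

definition digraph :: "'a digraph \<Rightarrow> bool" where
  "digraph G \<longleftrightarrow> finite (verts G) \<and> arcs G \<subseteq> verts G \<times> verts G"

text \<open>Homomorphisms and the homomorphism order.\<close>
definition is_hom :: "'a digraph \<Rightarrow> 'b digraph \<Rightarrow> ('a \<Rightarrow> 'b) \<Rightarrow> bool" where
  "is_hom G H f \<longleftrightarrow> (\<forall>x\<in>verts G. f x \<in> verts H) \<and>
     (\<forall>x y. (x, y) \<in> arcs G \<longrightarrow> (f x, f y) \<in> arcs H)"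

definition hom_le :: "'a digraph \<Rightarrow> 'b digraph \<Rightarrow> bool" where
  "hom_le G H \<longleftrightarrow> (\<exists>f. is_hom G H f)"

definition hom_lt :: "'a digraph \<Rightarrow> 'b digraph \<Rightarrow> bool" where
  "hom_lt G H \<longleftrightarrow> hom_le G H \<and> \<not> hom_le H G"

text \<open>Oriented paths: vertices listed p_0..p_n, arcs exactly one arc between
  p_(i-1) and p_i (in either direction) for each i.\<close>
definition oriented_path :: "'a digraph \<Rightarrow> bool" where
  "oriented_path P \<longleftrightarrow> digraph P \<and>
     (\<exists>ps. ps \<noteq> [] \<and> distinct ps \<and> set ps = verts P \<and>
        arcs P \<subseteq> {(ps ! i, ps ! Suc i) | i. Suc i < length ps}
                  \<union> {(ps ! Suc i, ps ! i) | i. Suc i < length ps} \<and>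
        (\<forall>i. Suc i < length ps \<longrightarrow>
           ((ps ! i, ps ! Suc i) \<in> arcs P \<longleftrightarrow> (ps ! Suc i, ps ! i) \<notin> arcs P)))"

text \<open>Oriented trees: orientations of finite trees (connected acyclic graphs).\<close>
definition adj :: "'a digraph \<Rightarrow> 'a \<Rightarrow> 'a \<Rightarrow> bool" where
  "adj G x y \<longleftrightarrow> (x, y) \<in> arcs G \<or> (y, x) \<in> arcs G"

definition is_orientation :: "'a digraph \<Rightarrow> bool" where
  "is_orientation G \<longleftrightarrow> (\<forall>x. (x, x) \<notin> arcs G) \<and>
     (\<forall>x y. (x, y) \<in> arcs G \<longrightarrow> (y, x) \<notin> arcs G)"

definition und_connected :: "'a digraph \<Rightarrow> bool" where
  "und_connected G \<longleftrightarrow> (\<forall>x\<in>verts G. \<forall>y\<in>verts G. (x, y) \<in> (arcs G \<union> (arcs G)\<inverse>)\<^sup>*)"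

text \<open>An (undirected) cycle of the underlying graph: distinct vertices v_0..v_k,
  k \<ge> 2, consecutive ones adjacent and v_k adjacent to v_0.\<close>
definition has_und_cycle :: "'a digraph \<Rightarrow> bool" where
  "has_und_cycle G \<longleftrightarrow> (\<exists>vs. length vs \<ge> 3 \<and> distinct vs \<and> set vs \<subseteq> verts G \<and>
     (\<forall>i. Suc i < length vs \<longrightarrow> adj G (vs ! i) (vs ! Suc i)) \<and>
     adj G (last vs) (hd vs))"

definition oriented_tree :: "'a digraph \<Rightarrow> bool" where
  "oriented_tree T \<longleftrightarrow> digraph T \<and> verts T \<noteq> {} \<and> is_orientation T \<and>
     und_connected T \<and> \<not> has_und_cycle T"

text \<open>The directed path P_k and the height of an oriented path.\<close>
definition dipath :: "nat \<Rightarrow> nat digraph" where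
  "dipath k = ({0..k}, {(i, Suc i) | i. i < k})"

definition height :: "'a digraph \<Rightarrow> nat" where
  "height P = (LEAST k. hom_le P (dipath k))"

end

theory Submission
  imports Defs
begin

text \<open>
  Replace \<open>P2\<close> by its core \<open>P\<close>, a path with vertices \<open>0, \<dots>, n\<close>. A graph \<open>T\<close> mapping to \<open>P\<close> lies
  strictly below \<open>P\<close> iff the map has no section. Labelling the vertices by whether a partial
  section from \<open>0\<close> reaches them, this says that \<open>T\<close> maps to the graph \<open>Q\<close> with vertices \<open>(k, True)\<close>
  for \<open>k < n\<close> and \<open>(k, False)\<close> for \<open>k > 0\<close>, lying over \<open>P\<close> with no edge from \<open>(k, True)\<close> to
  \<open>(k + 1, False)\<close>. In particular \<open>T1\<close> maps to \<open>Q\<close>. Hang all walks of \<open>Q\<close> up to a large length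
  on the vertices of \<open>T1\<close>; the resulting tree \<open>T\<close> still maps to \<open>Q\<close>, so \<open>T < P\<close>.

  Since the height is at least 4, some two consecutive inner arcs \<open>i\<close>, \<open>i + 1\<close> of \<open>P\<close> have the same
  direction. Suppose \<open>T\<close> maps to \<open>T1\<close> and follow in \<open>T\<close> the walk going round the 4-cycle
  \<open>(i, False)\<close>, \<open>(i + 1, True)\<close>, \<open>(i + 2, True)\<close>, \<open>(i + 1, False)\<close> of \<open>Q\<close> many times. Its image in \<open>T1\<close>
  never backtracks: at \<open>i + 1\<close> it follows two arcs of the same direction, and at \<open>i\<close> and \<open>i + 2\<close>
  backtracking would identify a vertex over \<open>(i + 1, True)\<close> with one over \<open>(i + 1, False)\<close>, which
  gives a map from \<open>P\<close> to \<open>T1\<close>. So the image is an arbitrarily long path in the finite tree \<open>T1\<close>.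
\<close>

section \<open>Homomorphisms and trees\<close>

lemma is_homI:
  assumes "\<And>x. x \<in> verts G \<Longrightarrow> f x \<in> verts H"
    and "\<And>x y. (x, y) \<in> arcs G \<Longrightarrow> (f x, f y) \<in> arcs H"
  shows "is_hom G H f"
  using assms by (simp add: is_hom_def)

lemma is_homD:
  assumes "is_hom G H f"
  shows "x \<in> verts G \<Longrightarrow> f x \<in> verts H"
    and "(x, y) \<in> arcs G \<Longrightarrow> (f x, f y) \<in> arcs H"
  using assms by (auto simp: is_hom_def)

lemma is_hom_comp:
  assumes "is_hom G H f" and "is_hom H K g"
  shows "is_hom G K (g \<circ> f)"
  using assms by (auto simp: is_hom_def)

lemma hom_le_trans: "hom_le G H \<Longrightarrow> hom_le H K \<Longrightarrow> hom_le G K"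
  unfolding hom_le_def by (blast intro: is_hom_comp)

lemma hom_adj: "is_hom G H f \<Longrightarrow> adj G x y \<Longrightarrow> adj H (f x) (f y)"
  by (auto simp: is_hom_def adj_def)

lemma adj_sym: "adj G x y \<longleftrightarrow> adj G y x"
  by (auto simp: adj_def)

lemma cycle_transfer:
  assumes cyc: "has_und_cycle G" and f: "\<And>x. x \<in> verts G \<Longrightarrow> f x \<in> verts H"
    "\<And>x y. adj G x y \<Longrightarrow> adj H (f x) (f y)" and inj: "inj_on f (verts G)"
  shows "has_und_cycle H"
proof -
  obtain vs where vs: "length vs \<ge> 3" "distinct vs" "set vs \<subseteq> verts G"
    "\<forall>i. Suc i < length vs \<longrightarrow> adj G (vs ! i) (vs ! Suc i)" "adj G (last vs) (hd vs)"
    using cyc unfolding has_und_cycle_def by blast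
  have ne: "vs \<noteq> []" using vs(1) by auto
  have "distinct (map f vs)"
    using vs(2,3) inj by (auto simp: distinct_map intro: inj_on_subset)
  moreover have "set (map f vs) \<subseteq> verts H" using vs(3) f(1) by auto
  moreover have "adj H (last (map f vs)) (hd (map f vs))"
    using vs(5) f(2) ne by (simp add: last_map hd_map)
  ultimately show ?thesis
    unfolding has_und_cycle_def using vs(1,4) f(2)
    by (intro exI[of _ "map f vs"]) auto
qed

text \<open>The walk tree has lists in its vertices, while the final tree must live on
  \<open>nat\<close>. Relabelling by an injection gives homs both ways, so every order relation
  carries over; a cycle in the copy is pulled back along the inverse.\<close>

lemma oriented_tree_image:
  assumes T: "oriented_tree T" and inj: "inj_on e (verts T)"
  defines "T' \<equiv> (e ` verts T, map_prod e e ` arcs T)"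
  shows "oriented_tree T'" and "is_hom T T' e" and "is_hom T' T (inv_into (verts T) e)"
proof -
  let ?r = "inv_into (verts T) e"
  have V: "verts T' = e ` verts T" and A: "arcs T' = map_prod e e ` arcs T"
    by (simp_all add: T'_def verts_def arcs_def)
  have sub: "arcs T \<subseteq> verts T \<times> verts T" and fin: "finite (verts T)"
    using T by (auto simp: oriented_tree_def digraph_def)
  show he: "is_hom T T' e" by (auto simp: is_hom_def V A)
  show hr: "is_hom T' T ?r"
    using sub inj by (auto simp: is_hom_def V A)
  have "digraph T'" using sub fin by (auto simp: digraph_def V A)
  moreover have "verts T' \<noteq> {}" using T by (simp add: V oriented_tree_def)
  moreover have "is_orientation T'"
    using T is_homD(2)[OF hr] unfolding oriented_tree_def is_orientation_def by blast
  moreover have "und_connected T'"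
  proof -
    have "(e x, e y) \<in> (arcs T' \<union> (arcs T')\<inverse>)\<^sup>*"
      if "(x, y) \<in> (arcs T \<union> (arcs T)\<inverse>)\<^sup>*" for x y
      using that
    proof induction
      case (step y z)
      then have "(e y, e z) \<in> arcs T' \<union> (arcs T')\<inverse>" using is_homD(2)[OF he] by blast
      with step.IH show ?case by (rule rtrancl_into_rtrancl)
    qed simp
    then show ?thesis using T by (auto simp: oriented_tree_def und_connected_def V)
  qed
  moreover have "\<not> has_und_cycle T'"
  proof
    assume "has_und_cycle T'"
    then have "has_und_cycle T"
      by (rule cycle_transfer) (use hr hom_adj[OF hr] in \<open>auto simp: is_hom_def V inj_on_inv_into\<close>)
    then show False using T by (simp add: oriented_tree_def)
  qed
  ultimately show "oriented_tree T'" by (simp add: oriented_tree_def)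
qed

text \<open>Take two equal positions at the least distance \<open>L\<close>. Distance 1 would be a
  loop and distance 2 a backtrack; for \<open>L\<close> at least 3, minimality makes the stretch
  between them a cycle of \<open>T\<close>.\<close>

lemma nonbacktracking_walk_inj:
  assumes T: "oriented_tree T"
    and v: "\<And>j. j < M \<Longrightarrow> adj T (v j) (v (Suc j))"
    and nb: "\<And>j. Suc j < M \<Longrightarrow> v j \<noteq> v (Suc (Suc j))"
  shows "inj_on v {..M}"
proof (rule ccontr)
  assume "\<not> inj_on v {..M}"
  then obtain a b where ab: "a < b" "b \<le> M" "v a = v b"
    unfolding inj_on_def by (metis atMost_iff linorder_neqE_nat)
  define L where "L = (LEAST l. 0 < l \<and> (\<exists>a. a + l \<le> M \<and> v a = v (a + l)))"
  have ex: "0 < b - a \<and> (\<exists>a'. a' + (b - a) \<le> M \<and> v a' = v (a' + (b - a)))"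
    using ab by (intro conjI exI[of _ a]) auto
  have L: "0 < L \<and> (\<exists>a. a + L \<le> M \<and> v a = v (a + L))"
    unfolding L_def by (rule LeastI[of "\<lambda>l. 0 < l \<and> (\<exists>a. a + l \<le> M \<and> v a = v (a + l))", OF ex])
  then obtain c where c: "c + L \<le> M" "v c = v (c + L)" by blast
  have least: "\<not> (a + l \<le> M \<and> v a = v (a + l))" if "0 < l" "l < L" for a l
    using not_less_Least[of l "\<lambda>l. 0 < l \<and> (\<exists>a. a + l \<le> M \<and> v a = v (a + l))"] that
    unfolding L_def by blast
  have noloop: "\<not> adj T x x" for x
    using T by (auto simp: oriented_tree_def is_orientation_def adj_def)
  have "L \<noteq> 1" using c v[of c] noloop by auto
  moreover have "L \<noteq> 2" using c nb[of c] by auto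
  ultimately have L3: "L \<ge> 3" using L by linarith
  let ?vs = "map v [c..<c + L]"
  have "inj_on v {c..<c + L}"
  proof (rule linorder_inj_onI)
    fix x y assume "x < y" "x \<in> {c..<c + L}" "y \<in> {c..<c + L}"
    then show "v x \<noteq> v y" using least[of "y - x" x] c(1) by auto
  qed auto
  then have "distinct ?vs" by (simp add: distinct_map)
  moreover have "set ?vs \<subseteq> verts T"
  proof
    fix z assume "z \<in> set ?vs"
    then obtain j where "z = v j" "j < M" using c(1) by auto
    then show "z \<in> verts T" using v[of j] T
      by (auto simp: adj_def oriented_tree_def digraph_def)
  qed
  moreover have "\<forall>i. Suc i < length ?vs \<longrightarrow> adj T (?vs ! i) (?vs ! Suc i)"
    using v c(1) by auto
  moreover have "adj T (last ?vs) (hd ?vs)"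
  proof -
    have "last ?vs = v (c + L - 1)" "hd ?vs = v c" using L3 by (simp_all add: last_map hd_map)
    then show ?thesis using v[of "c + L - 1"] c L3 by simp
  qed
  ultimately have "has_und_cycle T"
    unfolding has_und_cycle_def using L3 by (intro exI[of _ ?vs]) simp
  then show False using T by (simp add: oriented_tree_def)
qed

section \<open>Hanging walks onto a tree\<close>

text \<open>The start \<open>q\<close> is not stored in the list, so \<open>hd (w @ [q])\<close> is
  the current end of the walk, also when the list is empty.\<close>

primrec walk :: "'q digraph \<Rightarrow> 'q \<Rightarrow> 'q list \<Rightarrow> bool" where
  "walk Q q [] \<longleftrightarrow> True"
| "walk Q q (r # w) \<longleftrightarrow> walk Q q w \<and> adj Q (hd (w @ [q])) r"

text \<open>Walks are stored with their last vertex first, so that the parent of a walk is its tail.\<close>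
definition walk_tree_verts :: "'a digraph \<Rightarrow> 'q digraph \<Rightarrow> ('a \<Rightarrow> 'q) \<Rightarrow> nat \<Rightarrow> ('a \<times> 'q list) set" where
  "walk_tree_verts T Q g N = {(x, w). x \<in> verts T \<and> length w \<le> N \<and> walk Q (g x) w}"

text \<open>Walks may backtrack in \<open>Q\<close>. Since the vertices are whole walks and not
  their ends, each nonempty walk still has just one parent, and no cycle arises.\<close>

definition walk_tree :: "'a digraph \<Rightarrow> 'q digraph \<Rightarrow> ('a \<Rightarrow> 'q) \<Rightarrow> nat \<Rightarrow> ('a \<times> 'q list) digraph" where
  "walk_tree T Q g N = (walk_tree_verts T Q g N,
     {((x, []), (y, [])) | x y. (x, y) \<in> arcs T} \<union>
     {((x, w), (x, q # w)) | x w q. (x, q # w) \<in> walk_tree_verts T Q g N \<and> (hd (w @ [g x]), q) \<in> arcs Q} \<union>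
     {((x, q # w), (x, w)) | x w q. (x, q # w) \<in> walk_tree_verts T Q g N \<and> (q, hd (w @ [g x])) \<in> arcs Q})"

definition walk_end :: "('a \<Rightarrow> 'q) \<Rightarrow> 'a \<times> 'q list \<Rightarrow> 'q" where
  "walk_end g p = hd (snd p @ [g (fst p)])"

lemma verts_walk_tree: "verts (walk_tree T Q g N) = walk_tree_verts T Q g N"
  by (simp add: walk_tree_def verts_def)

lemma arcs_walk_tree:
  "arcs (walk_tree T Q g N) =
     {((x, []), (y, [])) | x y. (x, y) \<in> arcs T} \<union>
     {((x, w), (x, q # w)) | x w q. (x, q # w) \<in> walk_tree_verts T Q g N \<and> (hd (w @ [g x]), q) \<in> arcs Q} \<union>
     {((x, q # w), (x, w)) | x w q. (x, q # w) \<in> walk_tree_verts T Q g N \<and> (q, hd (w @ [g x])) \<in> arcs Q}"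
  by (simp add: walk_tree_def arcs_def)

lemma walk_tree_verts_Cons:
  "(x, q # w) \<in> walk_tree_verts T Q g N \<longleftrightarrow>
     (x, w) \<in> walk_tree_verts T Q g N \<and> length w < N \<and> adj Q (hd (w @ [g x])) q"
  by (auto simp: walk_tree_verts_def)

lemma walk_end_simps [simp]: "walk_end g (x, []) = g x" "walk_end g (x, q # w) = q"
  by (simp_all add: walk_end_def)

lemma walk_set: "digraph Q \<Longrightarrow> walk Q q w \<Longrightarrow> set w \<subseteq> verts Q"
  by (induction w) (auto simp: digraph_def adj_def)

lemma hom_walk_end:
  assumes g: "is_hom T Q g" and Q: "digraph Q"
  shows "is_hom (walk_tree T Q g N) Q (walk_end g)"
proof (rule is_homI)
  fix p assume "p \<in> verts (walk_tree T Q g N)"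
  then obtain x w where p: "p = (x, w)" "x \<in> verts T" "walk Q (g x) w"
    by (auto simp: verts_walk_tree walk_tree_verts_def)
  then show "walk_end g p \<in> verts Q"
    using walk_set[OF Q p(3)] is_homD(1)[OF g] by (cases w) auto
next
  fix p p' assume "(p, p') \<in> arcs (walk_tree T Q g N)"
  then show "(walk_end g p, walk_end g p') \<in> arcs Q"
    using is_homD(2)[OF g] by (auto simp: arcs_walk_tree walk_end_def)
qed

lemma hom_into_walk_tree: "is_hom T (walk_tree T Q g N) (\<lambda>x. (x, []))"
  by (auto simp: is_hom_def verts_walk_tree arcs_walk_tree walk_tree_verts_def)

lemma digraph_walk_tree:
  assumes "digraph T" and Q: "digraph Q"
  shows "digraph (walk_tree T Q g N)"
proof -
  have "walk_tree_verts T Q g N \<subseteq> verts T \<times> {w. set w \<subseteq> verts Q \<and> length w \<le> N}"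
    using walk_set[OF Q] by (auto simp: walk_tree_verts_def)
  moreover have "finite (verts T \<times> {w. set w \<subseteq> verts Q \<and> length w \<le> N})"
    using assms by (simp add: digraph_def finite_lists_length_le)
  ultimately have "finite (walk_tree_verts T Q g N)" by (rule finite_subset)
  moreover have "(x, []) \<in> walk_tree_verts T Q g N" if "x \<in> verts T" for x
    using that by (simp add: walk_tree_verts_def)
  ultimately show ?thesis
    using assms by (auto simp: digraph_def verts_walk_tree arcs_walk_tree walk_tree_verts_Cons)
qed

lemma connected_walk_tree:
  assumes "und_connected T"
  shows "und_connected (walk_tree T Q g N)"
proof -
  let ?W = "walk_tree T Q g N"
  let ?R = "arcs ?W \<union> (arcs ?W)\<inverse>"
  have sym: "sym (?R\<^sup>*)" by (rule sym_rtrancl) (auto simp: sym_def)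
  have root: "((x, []), (x, w)) \<in> ?R\<^sup>*" if "(x, w) \<in> verts ?W" for x w
    using that
  proof (induction w)
    case (Cons q w)
    then have "((x, w), (x, q # w)) \<in> ?R"
      by (auto simp: verts_walk_tree walk_tree_verts_Cons arcs_walk_tree adj_def)
    moreover have "((x, []), (x, w)) \<in> ?R\<^sup>*"
      using Cons by (auto simp: verts_walk_tree walk_tree_verts_Cons)
    ultimately show ?case by (rule rtrancl_into_rtrancl[rotated])
  qed simp
  have base: "((x, []), (y, [])) \<in> ?R\<^sup>*" if "(x, y) \<in> (arcs T \<union> (arcs T)\<inverse>)\<^sup>*" for x y
    using that
  proof induction
    case (step y z)
    then have "((y, []), (z, [])) \<in> ?R" by (auto simp: arcs_walk_tree)
    with step.IH show ?case by (rule rtrancl_into_rtrancl)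
  qed simp
  show ?thesis
    unfolding und_connected_def
  proof safe
    fix x w y u assume xw: "(x, w) \<in> verts ?W" and yu: "(y, u) \<in> verts ?W"
    have "((x, w), (x, [])) \<in> ?R\<^sup>*" using root[OF xw] sym by (blast dest: symD)
    also have "((x, []), (y, [])) \<in> ?R\<^sup>*"
      using assms xw yu
      by (intro base) (auto simp: und_connected_def verts_walk_tree walk_tree_verts_def)
    also have "((y, []), (y, u)) \<in> ?R\<^sup>*" using root[OF yu] .
    finally show "((x, w), (y, u)) \<in> ?R\<^sup>*" .
  qed
qed

lemma orientation_walk_tree:
  assumes "is_orientation T" and "is_orientation Q"
  shows "is_orientation (walk_tree T Q g N)"
  using assms by (auto simp: is_orientation_def arcs_walk_tree)

text \<open>Hung arcs change the depth by exactly one and all other arcs join vertices of depth 0,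
  so below the roots the only neighbour that is not deeper is the parent.\<close>

lemma adj_walk_tree_shallower:
  assumes "adj (walk_tree T Q g N) p p'" "length (snd p') \<le> length (snd p)" "snd p \<noteq> []"
  shows "p' = (fst p, tl (snd p))"
  using assms by (auto simp: adj_def arcs_walk_tree)

lemma adj_walk_tree_root:
  assumes "adj (walk_tree T Q g N) p p'" "snd p = []" "snd p' = []"
  shows "adj T (fst p) (fst p')"
  using assms by (auto simp: adj_def arcs_walk_tree)

text \<open>A vertex of maximal depth on a cycle would have its parent as both of its neighbours.\<close>
lemma acyclic_walk_tree:
  assumes "\<not> has_und_cycle T"
  shows "\<not> has_und_cycle (walk_tree T Q g N)"
proof
  let ?W = "walk_tree T Q g N"
  assume "has_und_cycle ?W"
  then obtain vs where vs: "length vs \<ge> 3" "distinct vs" "set vs \<subseteq> verts ?W"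
    "\<forall>i. Suc i < length vs \<longrightarrow> adj ?W (vs ! i) (vs ! Suc i)" "adj ?W (last vs) (hd vs)"
    unfolding has_und_cycle_def by blast
  let ?L = "length vs"
  have ne: "vs \<noteq> []" using vs(1) by auto
  have cyc: "adj ?W (vs ! i) (vs ! (Suc i mod ?L))" if "i < ?L" for i
  proof (cases "Suc i = ?L")
    case True
    then have "last vs = vs ! i" "hd vs = vs ! 0" using ne by (simp_all add: last_conv_nth hd_conv_nth flip: True)
    then show ?thesis using vs(5) True by simp
  next
    case False
    then show ?thesis using vs(4) that by simp
  qed
  define t where "t = (ARG_MAX (\<lambda>i. length (snd (vs ! i))) i. i < ?L)"
  have "is_arg_max (\<lambda>i. length (snd (vs ! i))) (\<lambda>i. i < ?L) t"
    unfolding t_def is_arg_max_linorder using vs(1)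
    by (intro arg_max_nat_lemma[of _ 0 _ "Max ((\<lambda>i. length (snd (vs ! i))) ` {..<?L}) + 1", simplified is_arg_max_linorder])
       (auto simp: le_imp_less_Suc)
  then have t: "t < ?L" and max: "\<And>i. i < ?L \<Longrightarrow> length (snd (vs ! i)) \<le> length (snd (vs ! t))"
    by (auto simp: is_arg_max_linorder)
  show False
  \<comment> \<open>If the maximal depth is 0, the whole cycle lies in the root copy of
    \<open>T\<close> and projects to a cycle there.\<close>
  proof (cases "snd (vs ! t) = []")
    case True
    have root: "snd p = []" if "p \<in> set vs" for p
      using that max True by (auto simp: in_set_conv_nth)
    have "has_und_cycle T"
      unfolding has_und_cycle_def
    proof (intro exI[of _ "map fst vs"] conjI allI impI)
      show "distinct (map fst vs)"
        using vs(2) root by (auto simp: distinct_map inj_on_def prod_eq_iff)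
      show "set (map fst vs) \<subseteq> verts T"
        using vs(3) by (auto simp: verts_walk_tree walk_tree_verts_def)
      show "adj T (last (map fst vs)) (hd (map fst vs))"
        using vs(5) root ne by (simp add: last_map hd_map adj_walk_tree_root)
      fix i assume "Suc i < length (map fst vs)"
      then have i: "Suc i < ?L" by simp
      then have "adj T (fst (vs ! i)) (fst (vs ! Suc i))"
        using vs(4) by (intro adj_walk_tree_root root) auto
      then show "adj T (map fst vs ! i) (map fst vs ! Suc i)" using i by simp
    qed (use vs in simp)
    with assms show False by simp
  next
    case False
    define s where "s = (if t = 0 then ?L - 1 else t - 1)"
    have s: "s < ?L" "Suc s mod ?L = t" using t by (auto simp: s_def)
    let ?u = "Suc t mod ?L"
    have u: "?u < ?L" using ne by simp
    have "adj ?W (vs ! t) (vs ! s)" using cyc[OF s(1)] s(2) by (simp add: adj_sym)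
    then have "vs ! s = (fst (vs ! t), tl (snd (vs ! t)))"
      using False max s by (intro adj_walk_tree_shallower) auto
    moreover have "vs ! ?u = (fst (vs ! t), tl (snd (vs ! t)))"
      using cyc[OF t] False max u by (intro adj_walk_tree_shallower) auto
    ultimately have "s = ?u" using vs(2) s(1) u by (metis nth_eq_iff_index_eq)
    \<comment> \<open>The cyclic predecessor and successor of \<open>t\<close> differ because the
      cycle has at least three vertices.\<close>
    moreover have "s \<noteq> ?u"
      using t vs(1) by (cases "Suc t = ?L") (auto simp: s_def)
    ultimately show False by simp
  qed
qed

lemma oriented_tree_walk_tree:
  assumes "oriented_tree T" "digraph Q" "is_orientation Q"
  shows "oriented_tree (walk_tree T Q g N)"
  using assms
  by (auto simp: oriented_tree_def digraph_walk_tree orientation_walk_tree connected_walk_tree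
      acyclic_walk_tree verts_walk_tree walk_tree_verts_def intro!: exI[of _ "[]"])

text \<open>Walk lifting: a walk \<open>h\<close> of \<open>Q\<close> starting at the end of
  \<open>p\<close> is followed in the tree by prolonging \<open>p\<close> one vertex at a time. The
  depth grows by one per step, so \<open>l\<close> levels must be left below
  \<open>p\<close>.\<close>

lemma walk_tree_lift:
  assumes p: "p \<in> verts (walk_tree T Q g N)" and len: "length (snd p) + l \<le> N"
    and h0: "h 0 = walk_end g p" and h: "\<And>j. j < l \<Longrightarrow> adj Q (h j) (h (Suc j))"
  obtains v where "v 0 = p"
    "\<And>j. j \<le> l \<Longrightarrow> v j \<in> verts (walk_tree T Q g N) \<and> walk_end g (v j) = h j \<and>
       length (snd (v j)) = length (snd p) + j"
    "\<And>j. j < l \<Longrightarrow> (h j, h (Suc j)) \<in> arcs Q \<Longrightarrow> (v j, v (Suc j)) \<in> arcs (walk_tree T Q g N)"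
    "\<And>j. j < l \<Longrightarrow> (h (Suc j), h j) \<in> arcs Q \<Longrightarrow> (v (Suc j), v j) \<in> arcs (walk_tree T Q g N)"
proof -
  obtain x w where pxw: "p = (x, w)" by force
  define v where "v j = (x, rev (map (\<lambda>i. h (Suc i)) [0..<j]) @ w)" for j
  have vS: "v (Suc j) = (x, h (Suc j) # snd (v j))" for j by (simp add: v_def)
  have e: "walk_end g (v j) = h j" for j
    by (cases j) (use h0 pxw in \<open>simp_all add: v_def walk_end_def\<close>)
  have hd: "hd (snd (v j) @ [g x]) = h j" for j
    using e[of j] by (simp add: walk_end_def v_def)
  have len': "length (snd (v j)) = length w + j" for j by (simp add: v_def)
  have fst: "v j = (x, snd (v j))" for j by (simp add: v_def)
  have mem: "v j \<in> walk_tree_verts T Q g N" if "j \<le> l" for j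
    using that
  proof (induction j)
    case 0
    then show ?case using p pxw by (simp add: v_def verts_walk_tree)
  next
    case (Suc j)
    then show ?case
      unfolding vS walk_tree_verts_Cons
      using h[of j] len' len fst[of j] hd[of j] pxw by auto
  qed
  show thesis
  proof (rule that[of v])
    show "v 0 = p" by (simp add: v_def pxw)
    show "v j \<in> verts (walk_tree T Q g N) \<and> walk_end g (v j) = h j \<and>
       length (snd (v j)) = length (snd p) + j" if "j \<le> l" for j
      using mem[OF that] e len' pxw by (simp add: verts_walk_tree)
    fix j assume j: "j < l"
    have m: "(x, h (Suc j) # snd (v j)) \<in> walk_tree_verts T Q g N"
      using mem[of "Suc j"] j by (simp add: vS)
    show "(v j, v (Suc j)) \<in> arcs (walk_tree T Q g N)" if "(h j, h (Suc j)) \<in> arcs Q"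
    proof -
      have "((x, snd (v j)), (x, h (Suc j) # snd (v j))) \<in> arcs (walk_tree T Q g N)"
        using m that hd[of j] by (auto simp: arcs_walk_tree)
      then show ?thesis using fst[of j] vS[of j] by simp
    qed
    show "(v (Suc j), v j) \<in> arcs (walk_tree T Q g N)" if "(h (Suc j), h j) \<in> arcs Q"
    proof -
      have "((x, h (Suc j) # snd (v j)), (x, snd (v j))) \<in> arcs (walk_tree T Q g N)"
        using m that hd[of j] by (auto simp: arcs_walk_tree)
      then show ?thesis using fst[of j] vS[of j] by simp
    qed
  qed
qed

section \<open>Oriented paths\<close>

definition opath :: "nat \<Rightarrow> (nat \<Rightarrow> bool) \<Rightarrow> nat digraph" where
  "opath n d = ({..n}, {(k, Suc k) | k. k < n \<and> d k} \<union> {(Suc k, k) | k. k < n \<and> \<not> d k})"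

lemma verts_opath: "verts (opath n d) = {..n}"
  by (simp add: opath_def verts_def)

lemma arcs_opath_iff:
  "(x, y) \<in> arcs (opath n d) \<longleftrightarrow> (y = Suc x \<and> x < n \<and> d x) \<or> (x = Suc y \<and> y < n \<and> \<not> d y)"
  by (auto simp: opath_def arcs_def)

lemma is_hom_opath_iff:
  "is_hom (opath n d) G s \<longleftrightarrow> (\<forall>k\<le>n. s k \<in> verts G) \<and>
     (\<forall>k<n. if d k then (s k, s (Suc k)) \<in> arcs G else (s (Suc k), s k) \<in> arcs G)"
  by (auto simp: is_hom_def verts_opath arcs_opath_iff)

lemma finite_arcs_opath: "finite (arcs (opath n d))"
  by (rule finite_subset[of _ "{..n} \<times> {..n}"]) (auto simp: arcs_opath_iff)

lemma oriented_path_equiv_opath: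
  assumes "oriented_path P"
  obtains n d where "hom_le P (opath n d)" "hom_le (opath n d) P"
proof -
  obtain ps where ps: "ps \<noteq> []" "distinct ps" "set ps = verts P"
    "arcs P \<subseteq> {(ps ! i, ps ! Suc i) | i. Suc i < length ps} \<union> {(ps ! Suc i, ps ! i) | i. Suc i < length ps}"
    "\<And>i. Suc i < length ps \<Longrightarrow> (ps ! i, ps ! Suc i) \<in> arcs P \<longleftrightarrow> (ps ! Suc i, ps ! i) \<notin> arcs P"
    using assms unfolding oriented_path_def by blast
  define n where "n = length ps - 1"
  define d where "d i \<longleftrightarrow> (ps ! i, ps ! Suc i) \<in> arcs P" for i
  define r where "r = inv_into {..n} (\<lambda>i. ps ! i)"
  have len: "length ps = Suc n" using ps(1) by (simp add: n_def)
  have inj: "inj_on (\<lambda>i. ps ! i) {..n}"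
    using ps(2) len by (auto simp: inj_on_def nth_eq_iff_index_eq)
  have r: "r (ps ! i) = i" if "i \<le> n" for i
    using inj that by (simp add: r_def)
  have "is_hom (opath n d) P (\<lambda>i. ps ! i)"
    using ps(3,5) len by (auto simp: is_hom_opath_iff d_def)
  moreover have "is_hom P (opath n d) r"
  proof (rule is_homI)
    fix x assume "x \<in> verts P"
    then obtain i where "x = ps ! i" "i \<le> n"
      unfolding ps(3)[symmetric] in_set_conv_nth len less_Suc_eq_le by blast
    then show "r x \<in> verts (opath n d)" using r by (simp add: verts_opath)
  next
    fix x y assume xy: "(x, y) \<in> arcs P"
    then consider i where "Suc i < length ps" "x = ps ! i" "y = ps ! Suc i"
      | i where "Suc i < length ps" "x = ps ! Suc i" "y = ps ! i"
      using ps(4) by blast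
    then show "(r x, r y) \<in> arcs (opath n d)"
      using xy ps(5) len r by cases (auto simp: arcs_opath_iff d_def)
  qed
  ultimately show thesis using that by (auto simp: hom_le_def)
qed

text \<open>A discrete intermediate value argument: \<open>f\<close> changes by exactly one along
  each arc and so cannot cross \<open>c\<close> without attaining it.\<close>

lemma hom_opath_avoid:
  assumes f: "is_hom (opath n d) (opath n' d') f" and avoid: "\<And>k. k \<le> n \<Longrightarrow> f k \<noteq> c"
  shows "(\<forall>k\<le>n. f k < c) \<or> (\<forall>k\<le>n. f k > c)"
proof -
  have step: "f (Suc k) = Suc (f k) \<or> f k = Suc (f (Suc k))" if "k < n" for k
    using f that unfolding is_hom_opath_iff arcs_opath_iff by meson
  have "(f k < c \<longleftrightarrow> f 0 < c)" if "k \<le> n" for k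
    using that
  proof (induction k)
    case (Suc k)
    then show ?case using step[of k] avoid[of k] avoid[of "Suc k"] by auto
  qed simp
  then show ?thesis using avoid by (metis linorder_neqE_nat)
qed

text \<open>The core of an oriented path, found as an equivalent path of least length.\<close>
lemma oriented_path_core:
  assumes "oriented_path P"
  obtains n d where "hom_le P (opath n d)" "hom_le (opath n d) P"
    "\<And>f. is_hom (opath n d) (opath n d) f \<Longrightarrow> bij_betw f {..n} {..n}"
proof -
  define E where "E n \<longleftrightarrow> (\<exists>d. hom_le P (opath n d) \<and> hom_le (opath n d) P)" for n
  define n where "n = (LEAST n. E n)"
  have "\<exists>n. E n" using oriented_path_equiv_opath[OF assms] unfolding E_def by metis
  then have "E n" unfolding n_def by (rule LeastI_ex)
  then obtain d where d: "hom_le P (opath n d)" "hom_le (opath n d) P" unfolding E_def by blast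
  have least: "\<not> (hom_le (opath n d) (opath n' d') \<and> hom_le (opath n' d') (opath n d))"
    if "n' < n" for n' d'
  proof -
    have "\<not> E n'" using not_less_Least that unfolding n_def by blast
    then show ?thesis using d unfolding E_def by (meson hom_le_trans)
  qed
  have "bij_betw f {..n} {..n}" if f: "is_hom (opath n d) (opath n d) f" for f
  proof -
    have sub: "f ` {..n} \<subseteq> {..n}" using f by (auto simp: is_hom_opath_iff verts_opath)
    have "f ` {..n} = {..n}"
    proof (rule ccontr)
      assume "f ` {..n} \<noteq> {..n}"
      then obtain c where c: "c \<le> n" "\<And>k. k \<le> n \<Longrightarrow> f k \<noteq> c" using sub by fastforce
      from hom_opath_avoid[OF f c(2)] show False
      proof
        \<comment> \<open>The image lies in the initial segment before \<open>c\<close>, which is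
          then a shorter path equivalent to the whole one.\<close>
        assume lt: "\<forall>k\<le>n. f k < c"
        then have "0 < c" by auto
        have "is_hom (opath n d) (opath (c - 1) d) f"
          unfolding is_hom_opath_iff verts_opath
        proof (intro conjI allI impI)
          show "f k \<in> {..c - 1}" if "k \<le> n" for k
            using lt[rule_format, OF that] by simp
          fix k assume "k < n"
          then have "f k < c" "f (Suc k) < c"
            "if d k then (f k, f (Suc k)) \<in> arcs (opath n d) else (f (Suc k), f k) \<in> arcs (opath n d)"
            using f lt by (auto simp: is_hom_opath_iff)
          then show "if d k then (f k, f (Suc k)) \<in> arcs (opath (c - 1) d)
            else (f (Suc k), f k) \<in> arcs (opath (c - 1) d)"
            by (auto simp: arcs_opath_iff split: if_splits)
        qed
        moreover have "is_hom (opath (c - 1) d) (opath n d) id"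
          using c(1) by (auto simp: is_hom_opath_iff verts_opath arcs_opath_iff)
        moreover have "c - 1 < n" using \<open>0 < c\<close> c(1) by linarith
        ultimately show False using least unfolding hom_le_def by blast
      next
        \<comment> \<open>Likewise for the final segment after \<open>c\<close>, shifted down by
          \<open>Suc c\<close> so that it starts at 0.\<close>
        assume gt: "\<forall>k\<le>n. f k > c"
        have "c < f 0" "f 0 \<le> n" using gt sub by auto
        then have "c < n" by (rule order_less_le_trans)
        let ?d = "\<lambda>k. d (k + Suc c)"
        have "is_hom (opath n d) (opath (n - Suc c) ?d) (\<lambda>k. f k - Suc c)"
          unfolding is_hom_opath_iff verts_opath
        proof (intro conjI allI impI)
          show "f k - Suc c \<in> {..n - Suc c}" if "k \<le> n" for k
            using sub that by (auto intro!: diff_le_mono)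
          fix k assume "k < n"
          then have "f k > c" "f (Suc k) > c"
            and arc: "if d k then (f k, f (Suc k)) \<in> arcs (opath n d) else (f (Suc k), f k) \<in> arcs (opath n d)"
            using f gt by (auto simp: is_hom_opath_iff)
          then obtain a b where ab: "f k = a + Suc c" "f (Suc k) = b + Suc c"
            by (metis Suc_leI le_add_diff_inverse2)
          show "if d k then (f k - Suc c, f (Suc k) - Suc c) \<in> arcs (opath (n - Suc c) ?d)
            else (f (Suc k) - Suc c, f k - Suc c) \<in> arcs (opath (n - Suc c) ?d)"
            using arc unfolding ab by (auto simp: arcs_opath_iff less_diff_conv)
        qed
        moreover have "is_hom (opath (n - Suc c) ?d) (opath n d) (\<lambda>k. k + Suc c)"
          using \<open>c < n\<close> by (auto simp: is_hom_opath_iff verts_opath arcs_opath_iff)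
        moreover have "n - Suc c < n" using \<open>c < n\<close> by linarith
        ultimately show False using least unfolding hom_le_def by blast
      qed
    qed
    then show ?thesis by (simp add: bij_betw_def eq_card_imp_inj_on)
  qed
  with d that show thesis by blast
qed

text \<open>Composing with a hom back from the graph gives an automorphism, whose inverse corrects
  that hom to a section.\<close>
lemma core_path_section:
  assumes core: "\<And>h. is_hom (opath n d) (opath n d) h \<Longrightarrow> bij_betw h {..n} {..n}"
    and f: "is_hom G (opath n d) f" and s: "is_hom (opath n d) G s"
  obtains s' where "is_hom (opath n d) G s'" "\<And>k. k \<le> n \<Longrightarrow> f (s' k) = k"
proof -
  let ?P = "opath n d"
  define h where "h = f \<circ> s"
  have h: "is_hom ?P ?P h" unfolding h_def using s f by (rule is_hom_comp)
  have bij: "bij_betw h {..n} {..n}" using core[OF h] .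
  then have inj: "inj_on h {..n}" and im: "h ` {..n} = {..n}" by (auto simp: bij_betw_def)
  let ?r = "inv_into {..n} h"
  have sub: "arcs ?P \<subseteq> {..n} \<times> {..n}" by (auto simp: arcs_opath_iff)
  \<comment> \<open>An injective self-map of the finite arc set is onto, so every arc is the image
    of an arc and the inverse of \<open>h\<close> is a hom as well.\<close>
  have "map_prod h h ` arcs ?P = arcs ?P"
  proof (rule endo_inj_surj[OF finite_arcs_opath])
    show "map_prod h h ` arcs ?P \<subseteq> arcs ?P" using is_homD(2)[OF h] by auto
    show "inj_on (map_prod h h) (arcs ?P)"
      using map_prod_inj_on[OF inj inj] sub by (rule inj_on_subset)
  qed
  then have arcs_im: "\<exists>a b. (a, b) \<in> arcs ?P \<and> x = h a \<and> y = h b" if "(x, y) \<in> arcs ?P" for x y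
    using equalityD2[THEN subsetD, OF _ that] by blast
  have "is_hom ?P ?P ?r"
  proof (rule is_homI)
    fix x assume "x \<in> verts ?P"
    then show "?r x \<in> verts ?P" using im by (metis inv_into_into verts_opath)
  next
    fix x y assume "(x, y) \<in> arcs ?P"
    then obtain a b where "(a, b) \<in> arcs ?P" "x = h a" "y = h b" using arcs_im by blast
    moreover from this have "a \<in> {..n}" "b \<in> {..n}" using sub by auto
    ultimately show "(?r x, ?r y) \<in> arcs ?P" using inj by simp
  qed
  then have "is_hom ?P G (s \<circ> ?r)" using s by (rule is_hom_comp)
  moreover have "f ((s \<circ> ?r) k) = k" if "k \<le> n" for k
    using f_inv_into_f[of k h "{..n}"] that im by (simp add: h_def)
  ultimately show thesis using that by blast
qed

text \<open>If the inner arcs alternate in direction, the inner vertices lie on two levels.\<close>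
lemma alternating_opath_le_dipath3:
  assumes alt: "\<And>i. 1 \<le> i \<Longrightarrow> i + 3 \<le> n \<Longrightarrow> d i \<noteq> d (Suc i)"
  shows "hom_le (opath n d) (dipath 3)"
proof -
  have D: "verts (dipath 3) = {0..3}" "\<And>x y. (x, y) \<in> arcs (dipath 3) \<longleftrightarrow> y = Suc x \<and> x < 3"
    by (auto simp: dipath_def verts_def arcs_def)
  show ?thesis
  proof (cases "n \<le> 1")
    case True
    then have "n = 0 \<or> n = 1" by auto
    then have "is_hom (opath n d) (dipath 3) (\<lambda>k. if d 0 then k else 1 - k)"
      by (auto simp: is_hom_opath_iff D)
    then show ?thesis by (auto simp: hom_le_def)
  next
    case False
    have dalt: "d i \<longleftrightarrow> (d 1 \<longleftrightarrow> odd i)" if "1 \<le> i" "i + 2 \<le> n" for i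
      using that
    proof (induction i rule: dec_induct)
      case (step i)
      then show ?case using alt[of i] by auto
    qed simp
    \<comment> \<open>By \<open>dalt\<close>, an inner vertex \<open>j\<close> followed by an inner
      arc gets level 1 if that arc leaves \<open>j\<close> and level 2 if it enters
      \<open>j\<close>. In \<open>lev\<close>, the two end vertices are put one level above or below
      their neighbour, and only they can get level 0 or 3.\<close>
    define L where "L j = (if odd j = d 1 then 1 else 2 :: nat)" for j :: nat
    define lev where "lev k = (if k = 0 then (if d 0 then L 1 - 1 else L 1 + 1)
      else if k = n then (if d (n - 1) then L (n - 1) + 1 else L (n - 1) - 1) else L k)" for k
    have "is_hom (opath n d) (dipath 3) lev"
      unfolding is_hom_opath_iff D
    proof (intro conjI allI impI)
      show "lev k \<in> {0..3}" for k by (simp add: lev_def L_def)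
      fix k assume "k < n"
      then consider "k = 0" | "0 < k" "Suc k = n" | "0 < k" "k + 2 \<le> n" by linarith
      then show "if d k then lev (Suc k) = Suc (lev k) \<and> lev k < 3
        else lev k = Suc (lev (Suc k)) \<and> lev (Suc k) < 3"
      proof cases
        case 1
        then show ?thesis using False by (simp add: lev_def L_def)
      next
        case 2
        then have "n - 1 = k" by simp
        then show ?thesis using 2 by (simp add: lev_def L_def)
      next
        case 3
        then show ?thesis using dalt[of k] by (auto simp: lev_def L_def)
      qed
    qed
    then show ?thesis by (auto simp: hom_le_def)
  qed
qed

section \<open>Maps to a path without a section\<close>

text \<open>The label of a vertex over \<open>k\<close> records whether it may be the end of a partial section
  over \<open>0, \<dots>, k\<close>.\<close>
definition lift_verts :: "nat \<Rightarrow> (nat \<times> bool) set" where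
  "lift_verts n = {(k, a). k \<le> n \<and> (k = 0 \<longrightarrow> a) \<and> (k = n \<longrightarrow> \<not> a)}"

text \<open>The two implications express that a partial section ending over \<open>k\<close> extends
  along any edge to a vertex over \<open>k + 1\<close>. The label \<open>True\<close> is excluded
  over \<open>n\<close>, where the section would be complete.\<close>

definition lift_graph :: "nat \<Rightarrow> (nat \<Rightarrow> bool) \<Rightarrow> (nat \<times> bool) digraph" where
  "lift_graph n d = (lift_verts n,
     {((k, a), (l, b)). (k, a) \<in> lift_verts n \<and> (l, b) \<in> lift_verts n \<and>
        (k, l) \<in> arcs (opath n d) \<and> (l = Suc k \<and> a \<longrightarrow> b) \<and> (k = Suc l \<and> b \<longrightarrow> a)})"

lemma verts_lift_graph: "verts (lift_graph n d) = lift_verts n"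
  by (simp add: lift_graph_def verts_def)

lemma arcs_lift_graph_iff:
  "((k, a), (l, b)) \<in> arcs (lift_graph n d) \<longleftrightarrow>
     (k, a) \<in> lift_verts n \<and> (l, b) \<in> lift_verts n \<and>
     (l = Suc k \<and> d k \<and> (a \<longrightarrow> b) \<or> k = Suc l \<and> \<not> d l \<and> (b \<longrightarrow> a))"
  by (auto simp: lift_graph_def arcs_def arcs_opath_iff[unfolded arcs_def] lift_verts_def)

lemma adj_lift_graph_Suc:
  "adj (lift_graph n d) (k, a) (Suc k, b) \<longleftrightarrow>
     (k, a) \<in> lift_verts n \<and> (Suc k, b) \<in> lift_verts n \<and> (a \<longrightarrow> b)"
  by (auto simp: adj_def arcs_lift_graph_iff)

lemma adj_lift_graph_pred:
  "adj (lift_graph n d) (Suc k, b) (k, a) \<longleftrightarrow>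
     (k, a) \<in> lift_verts n \<and> (Suc k, b) \<in> lift_verts n \<and> (a \<longrightarrow> b)"
  by (simp add: adj_sym[of _ "(Suc k, b)"] adj_lift_graph_Suc)

lemma digraph_lift_graph: "digraph (lift_graph n d)"
proof -
  have "finite (lift_verts n)"
    by (rule finite_subset[of _ "{..n} \<times> UNIV"]) (auto simp: lift_verts_def)
  then show ?thesis by (auto simp: digraph_def verts_lift_graph arcs_lift_graph_iff)
qed

lemma orientation_lift_graph: "is_orientation (lift_graph n d)"
  by (auto simp: is_orientation_def arcs_lift_graph_iff)

lemma hom_fst_lift_graph: "is_hom (lift_graph n d) (opath n d) fst"
  by (auto simp: is_hom_def verts_lift_graph arcs_lift_graph_iff verts_opath arcs_opath_iff lift_verts_def)

text \<open>The vertices labelled \<open>True\<close> form a path, and so do those labelled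
  \<open>False\<close>. The edge between \<open>(1, False)\<close> and \<open>(2, True)\<close>
  joins the two; \<open>(2, True)\<close> exists because \<open>n\<close> is at least 3.\<close>

lemma connected_lift_graph:
  assumes n: "n \<ge> 3"
  shows "und_connected (lift_graph n d)"
proof -
  let ?Q = "lift_graph n d"
  let ?R = "arcs ?Q \<union> (arcs ?Q)\<inverse>"
  have R: "(p, q) \<in> ?R \<longleftrightarrow> adj ?Q p q" for p q by (auto simp: adj_def)
  have sym: "sym (?R\<^sup>*)" by (rule sym_rtrancl) (auto simp: sym_def)
  have True_reach: "((0, True), (k, True)) \<in> ?R\<^sup>*" if "k < n" for k
    using that
  proof (induction k)
    case (Suc k)
    then have "((k, True), (Suc k, True)) \<in> ?R"
      unfolding R by (simp add: adj_lift_graph_Suc lift_verts_def)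
    with Suc show ?case by (auto intro: rtrancl_into_rtrancl)
  qed simp
  have False_reach: "((1, False), (k, False)) \<in> ?R\<^sup>*" if "1 \<le> k" "k \<le> n" for k
    using that
  proof (induction k rule: dec_induct)
    case (step k)
    then have "((k, False), (Suc k, False)) \<in> ?R"
      unfolding R by (simp add: adj_lift_graph_Suc lift_verts_def)
    with step show ?case by (auto intro: rtrancl_into_rtrancl)
  qed simp
  have "((2, True), (1, False)) \<in> ?R"
    unfolding R using n by (simp add: adj_lift_graph_pred lift_verts_def numeral_2_eq_2)
  then have bridge: "((0, True), (1, False)) \<in> ?R\<^sup>*"
    using True_reach[of 2] n by (auto intro: rtrancl_into_rtrancl)
  have all: "((0, True), q) \<in> ?R\<^sup>*" if "q \<in> verts ?Q" for q
  proof -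
    obtain k a where q: "q = (k, a)" by force
    show ?thesis
    proof (cases a)
      case True
      then show ?thesis using q that True_reach[of k]
        by (auto simp: verts_lift_graph lift_verts_def)
    next
      case False
      then have "1 \<le> k" "k \<le> n" using q that by (auto simp: verts_lift_graph lift_verts_def)
      then show ?thesis using q False bridge False_reach[of k] by (auto intro: rtrancl_trans)
    qed
  qed
  show ?thesis
    unfolding und_connected_def
  proof (intro ballI)
    fix p q assume "p \<in> verts ?Q" "q \<in> verts ?Q"
    then show "(p, q) \<in> ?R\<^sup>*" using all sym by (meson rtrancl_trans symD)
  qed
qed

text \<open>A section must start at \<open>(0, True)\<close>, and the label \<open>True\<close> is
  forced upwards along every edge, but \<open>(n, True)\<close> is not a vertex.\<close>

lemma no_section_lift_graph:
  assumes s: "is_hom (opath n d) (lift_graph n d) s" and sec: "\<And>k. k \<le> n \<Longrightarrow> fst (s k) = k"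
  shows False
proof -
  have s': "s k = (k, snd (s k))" if "k \<le> n" for k using sec[OF that] by (simp add: prod_eq_iff)
  have "s k = (k, True)" if "k \<le> n" for k
    using that
  proof (induction k)
    case 0
    have "s 0 \<in> lift_verts n" using s by (simp add: is_hom_opath_iff verts_lift_graph)
    then show ?case using s'[of 0] by (auto simp: lift_verts_def)
  next
    case (Suc k)
    then have "s k = (k, True)" "k < n" by simp_all
    moreover have "adj (lift_graph n d) (s k) (s (Suc k))"
      using s \<open>k < n\<close> by (auto simp: is_hom_opath_iff adj_def split: if_splits)
    ultimately show ?case using s'[of "Suc k"] Suc.prems adj_lift_graph_Suc[of n d k True "snd (s (Suc k))"]
      by auto
  qed
  moreover have "s n \<in> lift_verts n" using s by (simp add: is_hom_opath_iff verts_lift_graph)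
  ultimately show False by (simp add: lift_verts_def)
qed

lemma hom_lift_graph_ex:
  assumes T: "digraph T" and f: "is_hom T (opath n d) f" and no: "\<not> hom_le (opath n d) T"
  obtains g where "is_hom T (lift_graph n d) g"
proof -
  define R where "R x \<longleftrightarrow> (\<exists>s. is_hom (opath (f x) d) T s \<and> s (f x) = x)" for x
  have fle: "f x \<le> n" if "x \<in> verts T" for x
    using is_homD(1)[OF f that] by (simp add: verts_opath)
  have mem: "(f x, R x) \<in> lift_verts n" if x: "x \<in> verts T" for x
  proof -
    have "R x" if "f x = 0"
      unfolding R_def using x that by (intro exI[of _ "\<lambda>_. x"]) (simp add: is_hom_opath_iff)
    moreover have "\<not> R x" if "f x = n"
      using no that by (auto simp: R_def hom_le_def)
    ultimately show ?thesis using fle[OF x] by (auto simp: lift_verts_def)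
  qed
  have ext: "R y" if "R x" "y \<in> verts T" "f y = Suc (f x)"
    "if d (f x) then (x, y) \<in> arcs T else (y, x) \<in> arcs T" for x y
  proof -
    obtain s where s: "is_hom (opath (f x) d) T s" "s (f x) = x" using \<open>R x\<close> unfolding R_def by blast
    have "is_hom (opath (f y) d) T (s(f y := y))"
      unfolding is_hom_opath_iff
    proof (intro conjI allI impI)
      show "(s(f y := y)) k \<in> verts T" if "k \<le> f y" for k
        using s(1) that \<open>y \<in> verts T\<close> \<open>f y = Suc (f x)\<close> by (auto simp: is_hom_opath_iff le_Suc_eq)
      fix k assume "k < f y"
      then consider "k < f x" | "k = f x" using \<open>f y = Suc (f x)\<close> by linarith
      then show "if d k then ((s(f y := y)) k, (s(f y := y)) (Suc k)) \<in> arcs T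
        else ((s(f y := y)) (Suc k), (s(f y := y)) k) \<in> arcs T"
        using s that(3,4) by cases (simp_all add: is_hom_opath_iff)
    qed
    then show ?thesis unfolding R_def by (intro exI[of _ "s(f y := y)"]) simp
  qed
  have "is_hom T (lift_graph n d) (\<lambda>x. (f x, R x))"
  proof (rule is_homI)
    show "(f x, R x) \<in> verts (lift_graph n d)" if "x \<in> verts T" for x
      using mem[OF that] by (simp add: verts_lift_graph)
    fix x y assume xy: "(x, y) \<in> arcs T"
    then have V: "x \<in> verts T" "y \<in> verts T" using T by (auto simp: digraph_def)
    have "(f x, f y) \<in> arcs (opath n d)" using is_homD(2)[OF f xy] .
    then consider "f y = Suc (f x)" "d (f x)" | "f x = Suc (f y)" "\<not> d (f y)"
      unfolding arcs_opath_iff by blast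
    then show "((f x, R x), (f y, R y)) \<in> arcs (lift_graph n d)"
    proof cases
      case 1
      then have "R x \<longrightarrow> R y" using ext[of x y] V xy by simp
      then show ?thesis using 1 mem[OF V(1)] mem[OF V(2)] unfolding arcs_lift_graph_iff by blast
    next
      case 2
      then have "R y \<longrightarrow> R x" using ext[of y x] V xy by simp
      then show ?thesis using 2 mem[OF V(1)] mem[OF V(2)] unfolding arcs_lift_graph_iff by blast
    qed
  qed
  then show thesis by (rule that)
qed

section \<open>The walk tree does not map back\<close>

text \<open>Identifying the ends of a partial section from the left and one from the right would
  produce a copy of the whole path.\<close>
lemma walk_tree_separates:
  fixes T :: "'a digraph" and g :: "'a \<Rightarrow> nat \<times> bool" and d n N
  defines "W \<equiv> walk_tree T (lift_graph n d) g N"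
  assumes g: "is_hom T (lift_graph n d) g" and phi: "is_hom W T \<phi>"
    and no: "\<not> hom_le (opath n d) T"
    and p: "p \<in> verts W" "walk_end g p = (m, True)" "length (snd p) + n \<le> N"
    and p': "p' \<in> verts W" "walk_end g p' = (m, False)" "length (snd p') + n \<le> N"
  shows "\<phi> p \<noteq> \<phi> p'"
proof
  assume eq: "\<phi> p = \<phi> p'"
  let ?Q = "lift_graph n d"
  have hW: "is_hom W ?Q (walk_end g)"
    unfolding W_def by (rule hom_walk_end[OF g digraph_lift_graph])
  \<comment> \<open>The label \<open>True\<close> does not occur over \<open>n\<close>, nor
    \<open>False\<close> over 0.\<close>
  have m: "m < n" "0 < m"
    using is_homD(1)[OF hW p(1)] is_homD(1)[OF hW p'(1)] p(2) p'(2)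
    by (auto simp: verts_lift_graph lift_verts_def intro: Suc_leI le_neq_implies_less)
  \<comment> \<open>From \<open>p\<close> the tree contains a walk over the \<open>True\<close>
    vertices down to 0, and from \<open>p'\<close> one over the \<open>False\<close> vertices up to
    \<open>n\<close>; the spare depth \<open>n\<close> leaves room for both.\<close>
  have left: "adj ?Q (m - j, True) (m - Suc j, True)" if "j < m" for j
  proof -
    have "adj ?Q (m - Suc j, True) (Suc (m - Suc j), True)"
      using m that by (auto simp: adj_lift_graph_Suc lift_verts_def)
    moreover have "Suc (m - Suc j) = m - j" using that by (rule Suc_diff_Suc)
    ultimately show ?thesis by (simp add: adj_sym)
  qed
  obtain u where u: "u 0 = p" "\<And>j. j \<le> m \<Longrightarrow> u j \<in> verts W"
    "\<And>j. j < m \<Longrightarrow> ((m - j, True), (m - Suc j, True)) \<in> arcs ?Q \<Longrightarrow> (u j, u (Suc j)) \<in> arcs W"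
    "\<And>j. j < m \<Longrightarrow> ((m - Suc j, True), (m - j, True)) \<in> arcs ?Q \<Longrightarrow> (u (Suc j), u j) \<in> arcs W"
    unfolding W_def
    by (rule walk_tree_lift[of p T ?Q g N m "\<lambda>j. (m - j, True)"])
       (use p m left in \<open>simp_all add: W_def\<close>)
  have right: "adj ?Q (m + j, False) (m + Suc j, False)" if "j < n - m" for j
    using m that by (auto simp: adj_lift_graph_Suc lift_verts_def)
  obtain u' where u': "u' 0 = p'" "\<And>j. j \<le> n - m \<Longrightarrow> u' j \<in> verts W"
    "\<And>j. j < n - m \<Longrightarrow> ((m + j, False), (m + Suc j, False)) \<in> arcs ?Q \<Longrightarrow> (u' j, u' (Suc j)) \<in> arcs W"
    "\<And>j. j < n - m \<Longrightarrow> ((m + Suc j, False), (m + j, False)) \<in> arcs ?Q \<Longrightarrow> (u' (Suc j), u' j) \<in> arcs W"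
    unfolding W_def
    by (rule walk_tree_lift[of p' T ?Q g N "n - m" "\<lambda>j. (m + j, False)"])
       (use p' m right in \<open>simp_all add: W_def\<close>)
  \<comment> \<open>The two images in \<open>T\<close> are glued at \<open>k = m\<close>, where they
    agree by \<open>eq\<close>.\<close>
  define s where "s k = (if k \<le> m then \<phi> (u (m - k)) else \<phi> (u' (k - m)))" for k
  have s_right: "s k = \<phi> (u' (k - m))" if "m \<le> k" for k
    using that eq u(1) u'(1) by (cases "k = m") (auto simp: s_def)
  have "is_hom (opath n d) T s"
    unfolding is_hom_opath_iff
  proof (intro conjI allI impI)
    show "s k \<in> verts T" if "k \<le> n" for k
      using that u(2) u'(2) is_homD(1)[OF phi] by (auto simp: s_def)
    fix k assume k: "k < n"
    show "if d k then (s k, s (Suc k)) \<in> arcs T else (s (Suc k), s k) \<in> arcs T"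
    proof (cases "k < m")
      case True
      define j where "j = m - Suc k"
      have j: "j < m" "m - j = Suc k" "m - Suc j = k" "m - k = Suc j" using True by (auto simp: j_def)
      have sk: "s k = \<phi> (u (Suc j))" "s (Suc k) = \<phi> (u j)" using True j by (auto simp: s_def j_def)
      show ?thesis
        using u(3,4)[OF j(1)] j(2,3) m True is_homD(2)[OF phi] unfolding sk
        by (auto simp: arcs_lift_graph_iff lift_verts_def)
    next
      case False
      define j where "j = k - m"
      have j: "j < n - m" "m + j = k" "m + Suc j = Suc k" using False k by (auto simp: j_def)
      have sk: "s k = \<phi> (u' j)" "s (Suc k) = \<phi> (u' (Suc j))"
        using False j s_right[of k] s_right[of "Suc k"] by (auto simp: j_def Suc_diff_le)
      show ?thesis
        using u'(3,4)[OF j(1)] j(2,3) m False k is_homD(2)[OF phi] unfolding sk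
        by (auto simp: arcs_lift_graph_iff lift_verts_def)
    qed
  qed
  with no show False by (auto simp: hom_le_def)
qed

lemma walk_tree_no_hom_back:
  fixes T :: "'a digraph" and g :: "'a \<Rightarrow> nat \<times> bool" and d n N
  defines "W \<equiv> walk_tree T (lift_graph n d) g N"
  assumes T: "oriented_tree T" and g: "is_hom T (lift_graph n d) g"
    and no: "\<not> hom_le (opath n d) T"
    and i: "1 \<le> i" "i + 3 \<le> n" "d i = d (Suc i)"
    and p: "p \<in> verts W" "walk_end g p = (i, False)" "length (snd p) + card (verts T) + n \<le> N"
  shows "\<not> hom_le W T"
proof
  assume "hom_le W T"
  then obtain \<phi> where phi: "is_hom W T \<phi>" unfolding hom_le_def by blast
  let ?Q = "lift_graph n d"
  \<comment> \<open>A walk of \<open>M\<close> steps without repetition has \<open>M + 1\<close>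
    vertices, one more than \<open>T\<close> has.\<close>
  define M where "M = card (verts T)"
  define h where "h j = (if j mod 4 = 0 then (i, False) else if j mod 4 = 1 then (Suc i, True)
    else if j mod 4 = 2 then (Suc (Suc i), True) else (Suc i, False))" for j :: nat
  have V: "(i, False) \<in> lift_verts n" "(Suc i, True) \<in> lift_verts n"
    "(Suc (Suc i), True) \<in> lift_verts n" "(Suc i, False) \<in> lift_verts n"
    using i by (auto simp: lift_verts_def)
  have adjQ: "adj ?Q (h j) (h (Suc j))" for j
  proof -
    have "j mod 4 \<in> {0, 1, 2, 3}" by auto
    then show ?thesis
      using V by (auto simp: h_def mod_Suc adj_lift_graph_Suc adj_lift_graph_pred)
  qed
  obtain v where v: "v 0 = p"
    "\<And>j. j \<le> M \<Longrightarrow> v j \<in> verts W \<and> walk_end g (v j) = h j \<and> length (snd (v j)) = length (snd p) + j"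
    "\<And>j. j < M \<Longrightarrow> (h j, h (Suc j)) \<in> arcs ?Q \<Longrightarrow> (v j, v (Suc j)) \<in> arcs W"
    "\<And>j. j < M \<Longrightarrow> (h (Suc j), h j) \<in> arcs ?Q \<Longrightarrow> (v (Suc j), v j) \<in> arcs W"
    unfolding W_def
    by (rule walk_tree_lift[of p T ?Q g N M h])
       (use p adjQ in \<open>simp_all add: W_def M_def h_def\<close>)
  have "adj W (v j) (v (Suc j))" if "j < M" for j
    using v(3,4)[OF that] adjQ[of j] by (auto simp: adj_def)
  then have adjT: "adj T (\<phi> (v j)) (\<phi> (v (Suc j)))" if "j < M" for j
    using hom_adj[OF phi] that by blast
  have nb: "\<phi> (v j) \<noteq> \<phi> (v (Suc (Suc j)))" if j: "Suc j < M" for j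
  \<comment> \<open>For even \<open>j\<close> the middle vertex lies over \<open>i + 1\<close>,
    where both arcs are traversed in the same sense; equal ends would give opposite arcs in
    \<open>T\<close>. For odd \<open>j\<close> the outer vertices are \<open>(i + 1, True)\<close>
    and \<open>(i + 1, False)\<close> in some order, and the separation lemma applies.\<close>
  proof (cases "even j")
    case True
    then have "j mod 4 = 0 \<or> j mod 4 = 2" by presburger
    then have "(h j, h (Suc j)) \<in> arcs ?Q \<and> (h (Suc j), h (Suc (Suc j))) \<in> arcs ?Q \<or>
      (h (Suc j), h j) \<in> arcs ?Q \<and> (h (Suc (Suc j)), h (Suc j)) \<in> arcs ?Q"
      using V i(3) by (auto simp: h_def mod_Suc arcs_lift_graph_iff)
    then have "(\<phi> (v j), \<phi> (v (Suc j))) \<in> arcs T \<and> (\<phi> (v (Suc j)), \<phi> (v (Suc (Suc j)))) \<in> arcs T \<or>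
      (\<phi> (v (Suc j)), \<phi> (v j)) \<in> arcs T \<and> (\<phi> (v (Suc (Suc j))), \<phi> (v (Suc j))) \<in> arcs T"
      using v(3,4) j is_homD(2)[OF phi] by (meson Suc_lessD)
    then show ?thesis using T unfolding oriented_tree_def is_orientation_def by metis
  next
    case False
    then have "j mod 4 = 1 \<or> j mod 4 = 3" by presburger
    moreover have "v j \<in> verts W" "v (Suc (Suc j)) \<in> verts W"
      "walk_end g (v j) = h j" "walk_end g (v (Suc (Suc j))) = h (Suc (Suc j))"
      "length (snd (v j)) + n \<le> N" "length (snd (v (Suc (Suc j)))) + n \<le> N"
      using v(2)[of j] v(2)[of "Suc (Suc j)"] j p(3) by (auto simp: M_def)
    ultimately show ?thesis
      using walk_tree_separates[OF g phi[unfolded W_def] no, of "v j" "Suc i" "v (Suc (Suc j))"]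
        walk_tree_separates[OF g phi[unfolded W_def] no, of "v (Suc (Suc j))" "Suc i" "v j"]
      by (auto simp: W_def h_def mod_Suc)
  qed
  have inj: "inj_on (\<lambda>j. \<phi> (v j)) {..M}"
    using T adjT nb by (rule nonbacktracking_walk_inj)
  have "(\<lambda>j. \<phi> (v j)) ` {..M} \<subseteq> verts T" using v(2) is_homD(1)[OF phi] by blast
  moreover have "finite (verts T)" using T by (simp add: oriented_tree_def digraph_def)
  ultimately have "card {..M} \<le> card (verts T)" using inj by (metis card_inj_on_le)
  then show False by (simp add: M_def)
qed

section \<open>Assembling the tree strictly between \<open>T1\<close> and \<open>P2\<close>\<close>

theorem theorem5:
  fixes T1 :: "'a digraph" and P2 :: "'b digraph"
  assumes "oriented_tree T1"
    and "oriented_path P2"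
    and "hom_lt T1 P2"
    and "height P2 \<ge> 4"
  shows "\<exists>T :: nat digraph. oriented_tree T \<and> hom_lt T1 T \<and> hom_lt T P2"
proof -
  obtain n d where P: "hom_le P2 (opath n d)" "hom_le (opath n d) P2"
    and core: "\<And>f. is_hom (opath n d) (opath n d) f \<Longrightarrow> bij_betw f {..n} {..n}"
    using oriented_path_core[OF assms(2)] by metis
  let ?P = "opath n d" and ?Q = "lift_graph n d"
  have T1P: "hom_le T1 ?P" and no: "\<not> hom_le ?P T1"
    using assms(3) P unfolding hom_lt_def by (meson hom_le_trans)+
  \<comment> \<open>\<open>P2\<close> maps to whatever the core maps to, so the height bound forbids
    this map; hence the inner arcs of the core cannot alternate throughout.\<close>
  have "\<not> hom_le ?P (dipath 3)"
  proof
    assume "hom_le ?P (dipath 3)"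
    then have "hom_le P2 (dipath 3)" using P(1) hom_le_trans by blast
    then have "height P2 \<le> 3" unfolding height_def by (rule Least_le)
    with assms(4) show False by simp
  qed
  then obtain i where i: "1 \<le> i" "i + 3 \<le> n" "d i = d (Suc i)"
    using alternating_opath_le_dipath3 by blast
  obtain g where g: "is_hom T1 ?Q g"
    using T1P no hom_lift_graph_ex assms(1) unfolding hom_le_def oriented_tree_def by metis
  obtain x where x: "x \<in> verts T1" using assms(1) by (auto simp: oriented_tree_def)
  have "(i, False) \<in> verts ?Q" using i by (simp add: verts_lift_graph lift_verts_def)
  moreover have "und_connected ?Q" using i by (intro connected_lift_graph) simp
  ultimately have "(g x, (i, False)) \<in> (arcs ?Q \<union> (arcs ?Q)\<inverse>)\<^sup>*"
    using is_homD(1)[OF g x] unfolding und_connected_def by blast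
  then obtain h l where h: "h 0 = g x" "h l = (i, False)"
    "\<And>j. j < l \<Longrightarrow> (h j, h (Suc j)) \<in> arcs ?Q \<union> (arcs ?Q)\<inverse>"
    unfolding rtrancl_power relpow_fun_conv by blast
  \<comment> \<open>The depth budget: \<open>l\<close> steps to reach \<open>(i, False)\<close>,
    \<open>card (verts T1)\<close> steps round the 4-cycle, and \<open>n\<close> more for the
    separation argument at each vertex on the way.\<close>
  define N where "N = l + card (verts T1) + n"
  define W where "W = walk_tree T1 ?Q g N"
  have tree: "oriented_tree W"
    unfolding W_def using assms(1) digraph_lift_graph orientation_lift_graph
    by (rule oriented_tree_walk_tree)
  have WQ: "is_hom W ?Q (walk_end g)"
    unfolding W_def by (rule hom_walk_end[OF g digraph_lift_graph])
  have "adj ?Q (h j) (h (Suc j))" if "j < l" for j using h(3)[OF that] by (auto simp: adj_def)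
  moreover have "(x, []) \<in> verts W" using x by (simp add: W_def verts_walk_tree walk_tree_verts_def)
  ultimately obtain p where p: "p \<in> verts W" "walk_end g p = (i, False)" "length (snd p) = l"
    using walk_tree_lift[of "(x, [])" T1 ?Q g N l h] h(1,2) unfolding W_def N_def
    by (metis (no_types, lifting) add_0 le_add1 list.size(3) order_refl snd_conv walk_end_simps(1) add.assoc)
  have T1W: "hom_lt T1 W"
    unfolding hom_lt_def
  proof
    show "hom_le T1 W" using hom_into_walk_tree unfolding W_def hom_le_def by blast
    show "\<not> hom_le W T1"
      unfolding W_def using p
      by (intro walk_tree_no_hom_back[OF assms(1) g no i]) (auto simp: W_def N_def)
  qed
  have WP: "is_hom W ?P (fst \<circ> walk_end g)"
    using WQ hom_fst_lift_graph by (rule is_hom_comp)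
  have "\<not> hom_le ?P W"
  proof
    assume "hom_le ?P W"
    \<comment> \<open>As \<open>?P\<close> is a core, a hom into \<open>W\<close> can be corrected
      to a section; followed by \<open>walk_end g\<close> it would be a section of
      \<open>?Q\<close>.\<close>
    then obtain s where s: "is_hom ?P W s" "\<And>k. k \<le> n \<Longrightarrow> (fst \<circ> walk_end g) (s k) = k"
      using core_path_section[OF core WP] unfolding hom_le_def by metis
    show False
      using no_section_lift_graph[OF is_hom_comp[OF s(1) WQ]] s(2) by simp
  qed
  then have "hom_lt W ?P" using WP by (auto simp: hom_lt_def hom_le_def)
  then have WP2: "hom_lt W P2" using P unfolding hom_lt_def by (meson hom_le_trans)
  have "finite (verts W)" using tree by (simp add: oriented_tree_def digraph_def)
  then obtain e :: "_ \<Rightarrow> nat" where e: "inj_on e (verts W)"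
    using finite_imp_inj_to_nat_seg by metis
  define T where "T = (e ` verts W, map_prod e e ` arcs W)"
  have "oriented_tree T" "hom_le W T" "hom_le T W"
    using oriented_tree_image[OF tree e] unfolding T_def hom_le_def by blast+
  moreover from this have "hom_lt T1 T" "hom_lt T P2"
    using T1W WP2 unfolding hom_lt_def by (meson hom_le_trans)+
  ultimately show ?thesis by blast
qed

end
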